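(* Let $\alpha, \beta \in \mathbb{C}$ with $|\alpha| = |\beta| = 1$, and let $S_{\alpha,\beta} : \mathrm{Hol}(\mathbb{A}) \to \mathrm{Hol}(\mathbb{A})$ be defined by $S_{\alpha,\beta}(f)(z) = \alpha f(\beta/z)$. Then $$\sigma(S_{\alpha,\beta}) = \sigma_p(S_{\alpha,\beta}) = \{\alpha, -\alpha\}.$$ Moreover, $\ker(S_{\alpha,\beta} - \lambda\, \mathrm{Id})$ is infinite-dimensional for $\lambda \in \{\alpha, -\alpha\}$.
   Context: Fix a real number $R > 1$ and let $\mathbb{A} = \{z \in \mathbb{C} : 1/R < |z| < R\}$. $\mathrm{Hol}(\mathbb{A})$ is the Fréchet space of holomorphic functions $\mathbb{A} \to \mathbb{C}$ with the topology of uniform convergence on compact subsets. For a continuous linear operator $T$ on $\mathrm{Hol}(\mathbb{A})$, the spectrum $\sigma(T)$ is the set of $\lambda \in \mathbb{C}$ such that $T - \lambda\,\mathrm{Id}$ is not invertible on $\mathrm{Hol}(\mathbb{A})$, and the point spectrum $\sigma_p(T)$ is the set of $\lambda \in \mathbb{C}$ such that $T - \lambda\,\mathrm{Id}$ is not injective (the eigenvalues of $T$). *)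

theory Defs
  imports "HOL-Complex_Analysis.Complex_Analysis" "HOL-Library.Function_Algebras"
begin

definition annulus :: "real \<Rightarrow> complex set" where
  "annulus R = {z. 1 / R < norm z \<and> norm z < R}"

text \<open>
  Addition, subtraction and zero of functions are the pointwise ones from
  \<^theory>\<open>HOL-Library.Function_Algebras\<close>. Together with the following scalar
  multiplication they make \<^typ>\<open>complex \<Rightarrow> complex\<close> a complex vector space.
\<close>

definition cscale :: "complex \<Rightarrow> (complex \<Rightarrow> complex) \<Rightarrow> complex \<Rightarrow> complex" where
  "cscale c f = (\<lambda>z. c * f z)"

global_interpretation cfun: vector_space cscale
  by unfold_locales (auto simp: cscale_def fun_eq_iff algebra_simps)

text \<open>
  A function on \<open>X\<close> is represented by its extension by zero to the whole plane, so that
  equality of functions on \<open>X\<close> is equality in HOL and \<open>Hol X\<close> is a linear subspace.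
\<close>

definition Hol :: "complex set \<Rightarrow> (complex \<Rightarrow> complex) set" where
  "Hol X = {f. f holomorphic_on X \<and> (\<forall>z. z \<notin> X \<longrightarrow> f z = 0)}"

definition hol_nhd :: "complex set \<Rightarrow> (complex \<Rightarrow> complex) \<Rightarrow> complex set \<Rightarrow> real \<Rightarrow> (complex \<Rightarrow> complex) set" where
  "hol_nhd X f K e = {g \<in> Hol X. \<forall>z\<in>K. dist (g z) (f z) < e}"

text \<open>The topology of uniform convergence on compact subsets of \<open>X\<close>.\<close>

definition hol_topology :: "complex set \<Rightarrow> (complex \<Rightarrow> complex) topology" where
  "hol_topology X = topology (\<lambda>U. U \<subseteq> Hol X \<and>
     (\<forall>f\<in>U. \<exists>K e. compact K \<and> K \<subseteq> X \<and> 0 < e \<and> hol_nhd X f K e \<subseteq> U))"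

lemma openin_hol_topology:
  "openin (hol_topology X) U \<longleftrightarrow> U \<subseteq> Hol X \<and>
     (\<forall>f\<in>U. \<exists>K e. compact K \<and> K \<subseteq> X \<and> 0 < e \<and> hol_nhd X f K e \<subseteq> U)"
proof -
  let ?P = "\<lambda>U. U \<subseteq> Hol X \<and>
     (\<forall>f\<in>U. \<exists>K e. compact K \<and> K \<subseteq> X \<and> 0 < e \<and> hol_nhd X f K e \<subseteq> U)"
  have "istopology ?P"
    unfolding istopology_def
  proof (intro conjI allI impI)
    fix S T assume S: "?P S" and T: "?P T"
    show "S \<inter> T \<subseteq> Hol X" using S by blast
    show "\<forall>f\<in>S \<inter> T. \<exists>K e. compact K \<and> K \<subseteq> X \<and> 0 < e \<and> hol_nhd X f K e \<subseteq> S \<inter> T"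
    proof
      fix f assume f: "f \<in> S \<inter> T"
      obtain K e where 1: "compact K" "K \<subseteq> X" "0 < e" "hol_nhd X f K e \<subseteq> S"
        using S f by blast
      obtain L d where 2: "compact L" "L \<subseteq> X" "0 < d" "hol_nhd X f L d \<subseteq> T"
        using T f by blast
      have "hol_nhd X f (K \<union> L) (min e d) \<subseteq> hol_nhd X f K e \<inter> hol_nhd X f L d"
        by (auto simp: hol_nhd_def)
      then have "compact (K \<union> L) \<and> K \<union> L \<subseteq> X \<and> 0 < min e d \<and>
          hol_nhd X f (K \<union> L) (min e d) \<subseteq> S \<inter> T"
        using 1 2 by auto
      then show "\<exists>K e. compact K \<and> K \<subseteq> X \<and> 0 < e \<and> hol_nhd X f K e \<subseteq> S \<inter> T" by blast
    qed
  next
    fix \<K> assume "\<forall>S\<in>\<K>. ?P S"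
    then show "\<Union> \<K> \<subseteq> Hol X"
      and "\<forall>f\<in>\<Union> \<K>. \<exists>K e. compact K \<and> K \<subseteq> X \<and> 0 < e \<and> hol_nhd X f K e \<subseteq> \<Union> \<K>"
      by (blast, meson Union_iff Union_upper subset_trans)
  qed
  then show ?thesis
    unfolding hol_topology_def by (simp add: topology_inverse')
qed

lemma topspace_hol_topology: "topspace (hol_topology X) = Hol X"
proof -
  have "openin (hol_topology X) (Hol X)"
    unfolding openin_hol_topology
    by (metis (no_types, lifting) compact_empty empty_subsetI hol_nhd_def
        mem_Collect_eq order_refl subsetI zero_less_one)
  then show ?thesis
    unfolding topspace_def using openin_hol_topology by blast
qed

definition continuous_linear_operator ::
    "complex set \<Rightarrow> ((complex \<Rightarrow> complex) \<Rightarrow> (complex \<Rightarrow> complex)) \<Rightarrow> bool" where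
  "continuous_linear_operator X T \<longleftrightarrow>
     (\<forall>f\<in>Hol X. \<forall>g\<in>Hol X. T (f + g) = T f + T g) \<and>
     (\<forall>c. \<forall>f\<in>Hol X. T (cscale c f) = cscale c (T f)) \<and>
     continuous_map (hol_topology X) (hol_topology X) T"

text \<open>Invertibility in the algebra of continuous linear operators on \<open>Hol X\<close>.\<close>

definition hol_invertible ::
    "complex set \<Rightarrow> ((complex \<Rightarrow> complex) \<Rightarrow> (complex \<Rightarrow> complex)) \<Rightarrow> bool" where
  "hol_invertible X T \<longleftrightarrow>
     (\<exists>U. continuous_linear_operator X U \<and> (\<forall>f\<in>Hol X. U (T f) = f \<and> T (U f) = f))"

definition hol_spectrum ::
    "complex set \<Rightarrow> ((complex \<Rightarrow> complex) \<Rightarrow> (complex \<Rightarrow> complex)) \<Rightarrow> complex set" where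
  "hol_spectrum X T = {\<mu>. \<not> hol_invertible X (\<lambda>f. T f - cscale \<mu> f)}"

definition hol_point_spectrum ::
    "complex set \<Rightarrow> ((complex \<Rightarrow> complex) \<Rightarrow> (complex \<Rightarrow> complex)) \<Rightarrow> complex set" where
  "hol_point_spectrum X T = {\<mu>. \<not> inj_on (\<lambda>f. T f - cscale \<mu> f) (Hol X)}"

definition hol_kernel ::
    "complex set \<Rightarrow> ((complex \<Rightarrow> complex) \<Rightarrow> (complex \<Rightarrow> complex)) \<Rightarrow> (complex \<Rightarrow> complex) set" where
  "hol_kernel X T = {f \<in> Hol X. T f = 0}"

definition finite_dimensional :: "(complex \<Rightarrow> complex) set \<Rightarrow> bool" where
  "finite_dimensional V \<longleftrightarrow> (\<exists>B. finite B \<and> B \<subseteq> V \<and> cfun.span B = V)"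

text \<open>
  For \<open>norm \<beta> = 1\<close> the map \<open>z \<mapsto> \<beta> / z\<close> preserves both the annulus and its complement (as
  \<open>\<beta> / 0 = 0\<close>), so this formula is compatible with extension by zero; see the lemmas below.
\<close>

definition S_op :: "complex \<Rightarrow> complex \<Rightarrow> (complex \<Rightarrow> complex) \<Rightarrow> complex \<Rightarrow> complex" where
  "S_op \<alpha> \<beta> f = (\<lambda>z. \<alpha> * f (\<beta> / z))"

lemma annulus_div_iff:
  assumes "R > 1" "norm \<beta> = 1"
  shows "\<beta> / z \<in> annulus R \<longleftrightarrow> z \<in> annulus R"
proof (cases "z = 0")
  case False
  then have "norm z > 0" by simp
  then show ?thesis
    using assms by (auto simp: annulus_def norm_divide field_simps)
qed simp

lemma S_op_in_Hol:
  assumes "R > 1" "norm \<beta> = 1" "f \<in> Hol (annulus R)"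
  shows "S_op \<alpha> \<beta> f \<in> Hol (annulus R)"
proof -
  have 0: "0 \<notin> annulus R" using assms(1) by (auto simp: annulus_def)
  have "(\<lambda>z. \<beta> / z) holomorphic_on annulus R"
    using 0 by (intro holomorphic_intros) auto
  moreover have "(\<lambda>z. \<beta> / z) ` annulus R \<subseteq> annulus R"
    using annulus_div_iff[OF assms(1,2)] by auto
  moreover have "f holomorphic_on annulus R"
    using assms(3) by (simp add: Hol_def)
  ultimately have "(\<lambda>z. f (\<beta> / z)) holomorphic_on annulus R"
    using holomorphic_on_compose_gen[of "\<lambda>z. \<beta> / z" "annulus R" f "annulus R"]
    by (auto simp: o_def)
  then show ?thesis
    using assms(3) annulus_div_iff[OF assms(1,2)]
    by (auto simp: Hol_def S_op_def intro!: holomorphic_intros)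
qed

lemma continuous_linear_operator_S_op:
  assumes "R > 1" "norm \<alpha> = 1" "norm \<beta> = 1"
  shows "continuous_linear_operator (annulus R) (S_op \<alpha> \<beta>)"
proof -
  let ?X = "annulus R"
  have 0: "0 \<notin> ?X" using assms(1) by (auto simp: annulus_def)
  have "openin (hol_topology ?X) {f \<in> Hol ?X. S_op \<alpha> \<beta> f \<in> U}"
    if U: "openin (hol_topology ?X) U" for U
    unfolding openin_hol_topology
  proof (intro conjI ballI)
    fix f assume f: "f \<in> {f \<in> Hol ?X. S_op \<alpha> \<beta> f \<in> U}"
    then obtain K e where K: "compact K" "K \<subseteq> ?X" "0 < e"
        "hol_nhd ?X (S_op \<alpha> \<beta> f) K e \<subseteq> U"
      using U unfolding openin_hol_topology by blast
    let ?L = "(\<lambda>z. \<beta> / z) ` K"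
    have "compact ?L"
      using K 0 by (intro compact_continuous_image continuous_intros) auto
    moreover have "?L \<subseteq> ?X"
      using K(2) annulus_div_iff[OF assms(1,3)] by auto
    moreover have "S_op \<alpha> \<beta> g \<in> hol_nhd ?X (S_op \<alpha> \<beta> f) K e" if "g \<in> hol_nhd ?X f ?L e" for g
      using that S_op_in_Hol[OF assms(1,3)] assms(2)
      by (auto simp: hol_nhd_def S_op_def dist_norm norm_mult simp flip: right_diff_distrib)
    then have "hol_nhd ?X f ?L e \<subseteq> {f \<in> Hol ?X. S_op \<alpha> \<beta> f \<in> U}"
      using K(4) by (auto simp: hol_nhd_def)
    ultimately show "\<exists>K e. compact K \<and> K \<subseteq> ?X \<and> 0 < e \<and>
        hol_nhd ?X f K e \<subseteq> {f \<in> Hol ?X. S_op \<alpha> \<beta> f \<in> U}"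
      using K(3) by blast
  qed auto
  then have "continuous_map (hol_topology ?X) (hol_topology ?X) (S_op \<alpha> \<beta>)"
    using S_op_in_Hol[OF assms(1,3)]
    by (auto simp: continuous_map_def topspace_hol_topology)
  then show ?thesis
    by (auto simp: continuous_linear_operator_def S_op_def cscale_def fun_eq_iff algebra_simps)
qed

end

theory Submission
  imports Defs
begin

text \<open>
  Since \<open>z \<mapsto> \<beta> / z\<close> is an involution, \<open>S\<^sup>2 = \<alpha>\<^sup>2\<close>. Hence for \<open>\<mu>\<^sup>2 \<noteq> \<alpha>\<^sup>2\<close> the operator \<open>S - \<mu>\<close> has
  the inverse \<open>(S + \<mu>) / (\<alpha>\<^sup>2 - \<mu>\<^sup>2)\<close>. For \<open>s = \<plusminus>1\<close> the functions \<open>(z + s \<beta> / z) p(z + \<beta> / z)\<close>, with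
  \<open>p\<close> a polynomial, are eigenvectors for \<open>s \<alpha>\<close>. They depend injectively on \<open>p\<close>, because
  \<open>z \<mapsto> z + \<beta> / z\<close> is injective on \<open>norm z > 1\<close>, where \<open>z + s \<beta> / z\<close> has no zeros.
\<close>

section \<open>Continuity for uniform convergence on compact sets\<close>

lemma continuous_map_hol_topologyI:
  assumes "\<And>f. f \<in> Hol X \<Longrightarrow> T f \<in> Hol X"
    and "\<And>f K e. \<lbrakk>f \<in> Hol X; compact K; K \<subseteq> X; 0 < e\<rbrakk> \<Longrightarrow>
      \<exists>L d. compact L \<and> L \<subseteq> X \<and> 0 < d \<and> T ` hol_nhd X f L d \<subseteq> hol_nhd X (T f) K e"
  shows "continuous_map (hol_topology X) (hol_topology X) T"
  unfolding continuous_map_def topspace_hol_topology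
proof (intro conjI allI impI)
  show "T \<in> Hol X \<rightarrow> Hol X" using assms(1) by blast
  fix U assume U: "openin (hol_topology X) U"
  show "openin (hol_topology X) {f \<in> Hol X. T f \<in> U}"
    unfolding openin_hol_topology
  proof (intro conjI ballI)
    fix f assume f: "f \<in> {f \<in> Hol X. T f \<in> U}"
    \<comment> \<open>Openness of \<open>U\<close> supplies a basic neighbourhood of
      \<open>T f\<close>; the second assumption pulls it back to one of \<open>f\<close>.\<close>
    then obtain K e where K: "compact K" "K \<subseteq> X" "0 < e" "hol_nhd X (T f) K e \<subseteq> U"
      using U unfolding openin_hol_topology by blast
    then obtain L d where L: "compact L" "L \<subseteq> X" "0 < d"
        "T ` hol_nhd X f L d \<subseteq> hol_nhd X (T f) K e"
      using assms(2)[of f K e] f by blast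
    have "hol_nhd X f L d \<subseteq> {f \<in> Hol X. T f \<in> U}"
      using L(4) K(4) by (auto simp: hol_nhd_def)
    with L show "\<exists>K e. compact K \<and> K \<subseteq> X \<and> 0 < e \<and> hol_nhd X f K e \<subseteq> {f \<in> Hol X. T f \<in> U}"
      by blast
  qed auto
qed

lemma Hol_add: "f \<in> Hol X \<Longrightarrow> g \<in> Hol X \<Longrightarrow> f + g \<in> Hol X"
  by (auto simp: Hol_def plus_fun_def intro!: holomorphic_intros)

lemma Hol_cscale: "f \<in> Hol X \<Longrightarrow> cscale c f \<in> Hol X"
  by (auto simp: Hol_def cscale_def intro!: holomorphic_intros)

text \<open>The candidate inverse of \<open>S - \<mu>\<close> has this shape, and invertibility
  requires it to be continuous.\<close>

lemma continuous_linear_operator_S_op_combination: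
  assumes "R > 1" "norm \<beta> = 1"
  shows "continuous_linear_operator (annulus R)
    (\<lambda>f. cscale a (S_op \<alpha> \<beta> f) + cscale b f)"
proof -
  let ?X = "annulus R" and ?T = "\<lambda>f. cscale a (S_op \<alpha> \<beta> f) + cscale b f"
  have 0: "0 \<notin> ?X" using assms(1) by (auto simp: annulus_def)
  have Hol: "?T f \<in> Hol ?X" if "f \<in> Hol ?X" for f
    using that S_op_in_Hol[OF assms] by (intro Hol_add Hol_cscale)
  have "continuous_map (hol_topology ?X) (hol_topology ?X) ?T"
  proof (rule continuous_map_hol_topologyI[OF Hol])
    fix f K and e :: real assume f: "f \<in> Hol ?X" and K: "compact K" "K \<subseteq> ?X" "0 < e"
    \<comment> \<open>The value of \<open>?T g\<close> at \<open>z\<close> involves \<open>g\<close>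
      at both \<open>\<beta> / z\<close> and \<open>z\<close>, so closeness is needed on both
      sets.\<close>
    let ?L = "(\<lambda>z. \<beta> / z) ` K \<union> K"
    \<comment> \<open>On this union, \<open>M\<close> bounds the factor by which \<open>?T\<close>
      enlarges uniform distances. Dividing \<open>e\<close> by \<open>M + 1\<close> covers
      \<open>M = 0\<close> and makes the final estimate strict.\<close>
    define M where "M = norm a * norm \<alpha> + norm b"
    have M: "M \<ge> 0" by (simp add: M_def)
    define d where "d = e / (M + 1)"
    have d: "d > 0" using M K(3) by (simp add: d_def)
    have "compact ?L"
      using K 0 by (intro compact_Un compact_continuous_image continuous_intros) auto
    moreover have "?L \<subseteq> ?X"
      using K(2) annulus_div_iff[OF assms] by auto
    moreover have "?T g \<in> hol_nhd ?X (?T f) K e" if g: "g \<in> hol_nhd ?X f ?L d" for g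
    proof -
      have "dist (?T g z) (?T f z) < e" if z: "z \<in> K" for z
      proof -
        have 1: "norm (g z - f z) < d" "norm (g (\<beta> / z) - f (\<beta> / z)) < d"
          using g z by (auto simp: hol_nhd_def dist_norm)
        have "?T g z - ?T f z = a * \<alpha> * (g (\<beta> / z) - f (\<beta> / z)) + b * (g z - f z)"
          by (simp add: cscale_def S_op_def algebra_simps)
        then have "dist (?T g z) (?T f z)
            \<le> norm a * norm \<alpha> * norm (g (\<beta> / z) - f (\<beta> / z)) + norm b * norm (g z - f z)"
          unfolding dist_norm by (metis norm_mult norm_triangle_ineq)
        also have "\<dots> \<le> norm a * norm \<alpha> * d + norm b * d"
          using 1 by (intro add_mono mult_left_mono) auto
        also have "\<dots> = M * d" by (simp add: M_def algebra_simps)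
        also have "\<dots> < (M + 1) * d" using d by simp
        also have "\<dots> = e" using M by (simp add: d_def)
        finally show ?thesis .
      qed
      then show ?thesis using g Hol by (simp add: hol_nhd_def)
    qed
    ultimately show "\<exists>L d. compact L \<and> L \<subseteq> ?X \<and> 0 < d \<and>
        ?T ` hol_nhd ?X f L d \<subseteq> hol_nhd ?X (?T f) K e"
      using d by blast
  qed
  then show ?thesis
    by (auto simp: continuous_linear_operator_def S_op_def cscale_def fun_eq_iff algebra_simps)
qed

section \<open>Invertibility away from \<alpha> and -\<alpha>\<close>

lemma hol_invertible_S_op_diff:
  assumes "R > 1" "norm \<beta> = 1" "\<mu> \<notin> {\<alpha>, -\<alpha>}"
  shows "hol_invertible (annulus R) (\<lambda>f. S_op \<alpha> \<beta> f - cscale \<mu> f)"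
proof -
  define c where "c = inverse (\<alpha>\<^sup>2 - \<mu>\<^sup>2)"
  have "\<alpha>\<^sup>2 - \<mu>\<^sup>2 \<noteq> 0" using assms(3) by (auto simp: power2_eq_iff)
  then have c: "c * (\<alpha>\<^sup>2 - \<mu>\<^sup>2) = 1" by (simp add: c_def)
  let ?U = "\<lambda>f. cscale c (S_op \<alpha> \<beta> f) + cscale (c * \<mu>) f"
  have "?U (S_op \<alpha> \<beta> f - cscale \<mu> f) = f \<and> S_op \<alpha> \<beta> (?U f) - cscale \<mu> (?U f) = f"
    for f
  proof -
    \<comment> \<open>This includes \<open>z = 0\<close>, since division by zero yields 0. The
      inverse identities therefore hold pointwise on the whole plane.\<close>
    have "\<beta> / (\<beta> / z) = z" for z using assms(2) by auto
    moreover have "c * (\<alpha>\<^sup>2 * f z) - c * (\<mu>\<^sup>2 * f z) = f z" for z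
      using arg_cong[OF c, of "\<lambda>x. x * f z"] by (simp add: algebra_simps)
    ultimately show ?thesis
      by (simp add: fun_eq_iff S_op_def cscale_def algebra_simps power2_eq_square
          del: divide_divide_eq_right)
  qed
  with continuous_linear_operator_S_op_combination[OF assms(1,2)] show ?thesis
    unfolding hol_invertible_def by blast
qed

section \<open>Eigenfunctions built from polynomials\<close>

definition S_eigenfunction :: "real \<Rightarrow> complex \<Rightarrow> complex \<Rightarrow> complex poly \<Rightarrow> complex \<Rightarrow> complex" where
  "S_eigenfunction R \<beta> s p =
     (\<lambda>z. if z \<in> annulus R then (z + s * \<beta> / z) * poly p (z + \<beta> / z) else 0)"

text \<open>Replacing \<open>z\<close> by \<open>\<beta> / z\<close> fixes
  \<open>z + \<beta> / z\<close> and turns \<open>z + s * \<beta> / z\<close> into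
  \<open>\<beta> / z + s * z\<close>, which is \<open>s\<close> times the original because
  \<open>s\<^sup>2 = 1\<close>. Outside the annulus both sides vanish.\<close>

lemma S_eigenfunction_in_kernel:
  assumes "R > 1" "norm \<beta> = 1" "s\<^sup>2 = 1"
  shows "S_eigenfunction R \<beta> s p
    \<in> hol_kernel (annulus R) (\<lambda>f. S_op \<alpha> \<beta> f - cscale (s * \<alpha>) f)"
proof -
  let ?X = "annulus R"
  have 0: "0 \<notin> ?X" using assms(1) by (auto simp: annulus_def)
  have "(\<lambda>z. (z + s * \<beta> / z) * poly p (z + \<beta> / z)) holomorphic_on ?X"
    using 0 by (intro holomorphic_intros) auto
  then have "S_eigenfunction R \<beta> s p holomorphic_on ?X"
    by (rule holomorphic_transform) (simp add: S_eigenfunction_def)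
  moreover have "S_op \<alpha> \<beta> (S_eigenfunction R \<beta> s p) z = s * \<alpha> * S_eigenfunction R \<beta> s p z" for z
  proof (cases "z \<in> ?X")
    case True
    have "\<beta> \<noteq> 0" using assms(2) by auto
    moreover have "z \<noteq> 0" using True 0 by auto
    ultimately have "\<beta> / z + s * \<beta> / (\<beta> / z) = s * (z + s * \<beta> / z)"
        and "\<beta> / z + \<beta> / (\<beta> / z) = z + \<beta> / z"
      using assms(3) by (auto simp: field_simps power2_eq_square)
    then show ?thesis
      using True annulus_div_iff[OF assms(1,2), of z]
      by (simp add: S_op_def S_eigenfunction_def add.commute del: divide_divide_eq_right)
  next
    case False
    then show ?thesis
      using annulus_div_iff[OF assms(1,2), of z] by (simp add: S_op_def S_eigenfunction_def)
  qed
  ultimately show ?thesis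
    by (auto simp: hol_kernel_def Hol_def cscale_def fun_eq_iff S_eigenfunction_def)
qed

text \<open>Otherwise \<open>p\<close> would be a nonzero polynomial vanishing on the injective
  image of an infinite set.\<close>

lemma poly_eq_0_if_S_eigenfunction_eq_0:
  assumes "R > 1" "norm \<beta> = 1" "s\<^sup>2 = 1" "S_eigenfunction R \<beta> s p = 0"
  shows "p = 0"
proof (rule ccontr)
  assume "p \<noteq> 0"
  \<comment> \<open>A real segment is a convenient infinite subset of the outer half
    \<open>1 < norm z < R\<close> of the annulus.\<close>
  let ?A = "complex_of_real ` {1<..<R}"
  have s: "norm s = 1"
    using assms(3) by (metis norm_one norm_power norm_ge_zero power_eq_1_iff zero_neq_numeral)
  have "poly p (z + \<beta> / z) = 0" if z: "z \<in> ?A" for z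
  proof -
    have nz: "1 < norm z" "norm z < R" using z by auto
    then have "1 < norm z * norm z" by (simp add: less_1_mult)
    \<comment> \<open>A zero would satisfy \<open>z * z = - (s * \<beta>)\<close>, whose right side
      has modulus 1.\<close>
    have "z + s * \<beta> / z \<noteq> 0"
    proof
      assume "z + s * \<beta> / z = 0"
      moreover have "z \<noteq> 0" using nz by auto
      ultimately have "z * z + s * \<beta> = 0"
        by (simp add: divide_simps split: if_splits)
      then have "z * z = - (s * \<beta>)" by (rule eq_neg_iff_add_eq_0[THEN iffD2])
      then have "norm (z * z) = norm (s * \<beta>)" by simp
      then show False
        using \<open>1 < norm z * norm z\<close> s assms(2) by (simp add: norm_mult)
    qed
    moreover have "1 / R < norm z" using assms(1) nz by (smt (verit) divide_less_eq_1)
    then have "z \<in> annulus R" using nz unfolding annulus_def by auto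
    then have "(z + s * \<beta> / z) * poly p (z + \<beta> / z) = 0"
      using fun_cong[OF assms(4), of z] by (simp add: S_eigenfunction_def)
    ultimately show ?thesis by simp
  qed
  then have "(\<lambda>z. z + \<beta> / z) ` ?A \<subseteq> {x. poly p x = 0}" by auto
  then have "finite ((\<lambda>z. z + \<beta> / z) ` ?A)"
    using poly_roots_finite[OF \<open>p \<noteq> 0\<close>] finite_subset by blast
  moreover have "inj_on (\<lambda>z. z + \<beta> / z) ?A"
  proof (rule inj_onI)
    fix z u assume zu: "z \<in> ?A" "u \<in> ?A" "z + \<beta> / z = u + \<beta> / u"
    then have n: "1 < norm z" "1 < norm u" by auto
    then have "1 < norm z * norm u" by (simp add: less_1_mult)
    then have "z * u \<noteq> \<beta>" using assms(2) by (auto simp: norm_mult)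
    moreover have "z \<noteq> 0" "u \<noteq> 0" using n by auto
    \<comment> \<open>Clearing denominators in \<open>z + \<beta> / z = u + \<beta> / u\<close>
      gives this factorization; the second factor is nonzero by moduli.\<close>
    then have "(z - u) * (z * u - \<beta>) = 0"
      using zu(3) by (simp add: field_simps)
    ultimately show "z = u" by simp
  qed
  ultimately have "finite ?A" using finite_imageD by blast
  then have "finite {1<..<R}" by (rule finite_imageD) (simp add: inj_on_def)
  then show False using infinite_Ioo[OF assms(1)] by contradiction
qed

section \<open>Linearity in the polynomial and dimension of the kernels\<close>

lemma S_eigenfunction_0: "S_eigenfunction R \<beta> s 0 = 0"
  by (simp add: S_eigenfunction_def fun_eq_iff)

lemma S_eigenfunction_add:
  "S_eigenfunction R \<beta> s (p + q) = S_eigenfunction R \<beta> s p + S_eigenfunction R \<beta> s q"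
  by (simp add: S_eigenfunction_def fun_eq_iff algebra_simps)

lemma S_eigenfunction_diff:
  "S_eigenfunction R \<beta> s (p - q) = S_eigenfunction R \<beta> s p - S_eigenfunction R \<beta> s q"
  by (simp add: S_eigenfunction_def fun_eq_iff algebra_simps)

lemma S_eigenfunction_smult:
  "S_eigenfunction R \<beta> s (smult c p) = cscale c (S_eigenfunction R \<beta> s p)"
  by (simp add: S_eigenfunction_def cscale_def fun_eq_iff)

lemma S_eigenfunction_sum:
  "S_eigenfunction R \<beta> s (\<Sum>i\<in>I. p i) = (\<Sum>i\<in>I. S_eigenfunction R \<beta> s (p i))"
  by (induction I rule: infinite_finite_induct)
    (simp_all add: S_eigenfunction_0 S_eigenfunction_add)

text \<open>The monomials yield arbitrarily many independent eigenfunctions, more than any finite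
  spanning set allows.\<close>

lemma infinite_dimensional_kernel:
  assumes "R > 1" "norm \<beta> = 1" "s\<^sup>2 = 1"
  shows "\<not> finite_dimensional
    (hol_kernel (annulus R) (\<lambda>f. S_op \<alpha> \<beta> f - cscale (s * \<alpha>) f))"
proof
  let ?V = "hol_kernel (annulus R) (\<lambda>f. S_op \<alpha> \<beta> f - cscale (s * \<alpha>) f)"
  assume "finite_dimensional ?V"
  then obtain B where B: "finite B" "cfun.span B = ?V"
    unfolding finite_dimensional_def by blast
  define g where "g = (\<lambda>k. S_eigenfunction R \<beta> s (monom 1 k))"
  note inj = poly_eq_0_if_S_eigenfunction_eq_0[OF assms]
  \<comment> \<open>Needed both to count the eigenfunctions and to index a relation among them by
    exponents.\<close>
  have inj_g: "inj g"
  proof (rule injI)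
    fix m n assume "g m = g n"
    then have "S_eigenfunction R \<beta> s (monom 1 m - monom 1 n) = 0"
      by (simp add: g_def S_eigenfunction_diff)
    then have "monom (1::complex) m = monom 1 n" using inj by fastforce
    then show "m = n" by (metis degree_monom_eq zero_neq_one)
  qed
  \<comment> \<open>The range includes both 0 and \<open>card B\<close>, giving one vector more than
    \<open>B\<close> has.\<close>
  let ?A = "g ` {..card B}"
  have "cfun.independent ?A"
  proof (rule cfun.independent_if_scalars_zero)
    fix c x assume 0: "(\<Sum>x\<in>?A. cscale (c x) x) = 0" and x: "x \<in> ?A"
    \<comment> \<open>The coefficients of the relation become those of a polynomial whose
      eigenfunction is the vanishing combination, so the polynomial is 0.\<close>
    let ?p = "\<Sum>k\<le>card B. monom (c (g k)) k"
    have "S_eigenfunction R \<beta> s ?p = (\<Sum>k\<le>card B. cscale (c (g k)) (g k))"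
      unfolding S_eigenfunction_sum g_def
      by (simp flip: S_eigenfunction_smult add: smult_monom)
    also have "\<dots> = (\<Sum>x\<in>?A. cscale (c x) x)"
      by (simp add: sum.reindex[OF inj_on_subset[OF inj_g]])
    finally have "?p = 0" using inj 0 by simp
    then have "c (g j) = 0" if "j \<le> card B" for j
      using that coeff_sum[of "\<lambda>k. monom (c (g k)) k" "{..card B}" j] by simp
    then show "c x = 0" using x by auto
  qed auto
  moreover have "?A \<subseteq> cfun.span B"
    using S_eigenfunction_in_kernel[OF assms] by (auto simp: B(2) g_def)
  ultimately have "card ?A \<le> card B"
    using cfun.independent_span_bound[OF B(1)] by blast
  moreover have "card ?A = Suc (card B)"
    using card_image[OF inj_on_subset[OF inj_g]] by simp
  ultimately show False by simp
qed

section \<open>Comparison of the spectra\<close>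

lemma point_spectrum_if_infinite_dimensional_kernel:
  assumes "\<not> finite_dimensional (hol_kernel X (\<lambda>f. T f - cscale \<mu> f))" and "T 0 = 0"
  shows "\<mu> \<in> hol_point_spectrum X T"
proof (rule ccontr)
  let ?D = "\<lambda>f. T f - cscale \<mu> f"
  assume "\<mu> \<notin> hol_point_spectrum X T"
  then have inj: "inj_on ?D (Hol X)" by (simp add: hol_point_spectrum_def)
  have "0 \<in> Hol X"
    by (simp add: Hol_def zero_fun_def)
  moreover have "?D 0 = 0"
    using assms(2) by (simp add: cscale_def fun_eq_iff)
  ultimately have "hol_kernel X ?D = {0}"
    unfolding hol_kernel_def using inj_onD[OF inj, of _ 0] by auto
  \<comment> \<open>The zero space is the span of the empty set.\<close>
  then have "finite_dimensional (hol_kernel X ?D)"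
    unfolding finite_dimensional_def by (intro exI[of _ "{}"]) simp
  with assms(1) show False by contradiction
qed

text \<open>A two-sided inverse is in particular a left inverse, which forces injectivity.\<close>

lemma point_spectrum_subset_spectrum: "hol_point_spectrum X T \<subseteq> hol_spectrum X T"
  unfolding hol_point_spectrum_def hol_spectrum_def hol_invertible_def
  by (auto intro: inj_on_inverseI)

theorem theorem6p1:
  fixes R :: real and \<alpha> \<beta> :: complex
  assumes "R > 1" and "norm \<alpha> = 1" and "norm \<beta> = 1"
  shows "hol_spectrum (annulus R) (S_op \<alpha> \<beta>) = hol_point_spectrum (annulus R) (S_op \<alpha> \<beta>) \<and>
         hol_point_spectrum (annulus R) (S_op \<alpha> \<beta>) = {\<alpha>, -\<alpha>} \<and>
         (\<forall>\<mu>\<in>{\<alpha>, -\<alpha>}.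
            \<not> finite_dimensional (hol_kernel (annulus R) (\<lambda>f. S_op \<alpha> \<beta> f - cscale \<mu> f)))"
proof -
  have kernel: "\<forall>\<mu>\<in>{\<alpha>, -\<alpha>}.
      \<not> finite_dimensional (hol_kernel (annulus R) (\<lambda>f. S_op \<alpha> \<beta> f - cscale \<mu> f))"
    using infinite_dimensional_kernel[OF assms(1,3), of 1 \<alpha>]
      infinite_dimensional_kernel[OF assms(1,3), of "-1" \<alpha>] by simp
  have "S_op \<alpha> \<beta> 0 = 0" by (simp add: S_op_def fun_eq_iff)
  with kernel have "{\<alpha>, -\<alpha>} \<subseteq> hol_point_spectrum (annulus R) (S_op \<alpha> \<beta>)"
    using point_spectrum_if_infinite_dimensional_kernel by blast
  moreover have "hol_spectrum (annulus R) (S_op \<alpha> \<beta>) \<subseteq> {\<alpha>, -\<alpha>}"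
    using hol_invertible_S_op_diff[OF assms(1,3)] unfolding hol_spectrum_def by blast
  \<comment> \<open>The inclusions close up: \<open>{\<alpha>, -\<alpha>}\<close> lies in the point
    spectrum, that in the spectrum, and that in \<open>{\<alpha>, -\<alpha>}\<close>.\<close>
  ultimately show ?thesis
    using kernel point_spectrum_subset_spectrum[of "annulus R" "S_op \<alpha> \<beta>"] by blast
qed

end
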